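(* For all $n\ge 1$ and all $\varepsilon\in(0,(2n)^{-1}]$, the set $\mathcal{D}_{n,\varepsilon}$ of $n\times n$ $\varepsilon$-domestic matrices (with matrix multiplication and the standard topology) is a compact and convergent semigroup.
   Context: A matrix is doubly stochastic if it is a non-negative real square matrix in which every row and every column sums to $1$; $\mathcal{D}_n$ is the set of $n\times n$ doubly stochastic matrices. For $\varepsilon\in(0,(2n)^{-1}]$, a matrix $M\in\mathcal{D}_n$ is $\varepsilon$-domestic if there do not exist subsets $X,Y\subseteq\{1,\ldots,n\}$ with $X\neq Y$, $|X|=|Y|$ and $\sum_{i\in X,j\in Y}M[i,j]>(1-\varepsilon)|X|$. $\mathcal{D}_{n,\varepsilon}$ is the set of all $\varepsilon$-domestic matrices in $\mathcal{D}_n$, topologized as a subspace of $\mathbb{R}^{n^2}$. The (right) infinite product $\prod_{i\in\mathbb{N}}S_i$ in a topological semigroup $\mathcal{S}$ is the limit of the sequence $(S_0S_1\cdots S_i)_{i\in\mathbb{N}}$; it converges if the limit exists in $\mathcal{S}$. A topological semigroup (Hausdorff topology, continuous multiplication) is convergent if every infinite product of its elements converges. *)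

theory Defs
  imports "HOL-Analysis.Analysis"
begin

definition doubly_stochastic :: "real ^ 'n ^ 'n \<Rightarrow> bool" where
  "doubly_stochastic M \<longleftrightarrow>
     (\<forall>i j. 0 \<le> M $ i $ j) \<and>
     (\<forall>i. (\<Sum>j\<in>UNIV. M $ i $ j) = 1) \<and>
     (\<forall>j. (\<Sum>i\<in>UNIV. M $ i $ j) = 1)"

definition domestic :: "real \<Rightarrow> real ^ 'n ^ 'n \<Rightarrow> bool" where
  "domestic \<epsilon> M \<longleftrightarrow>
     doubly_stochastic M \<and>
     \<not> (\<exists>X Y :: 'n set. X \<noteq> Y \<and> card X = card Y \<and>
          (\<Sum>i\<in>X. \<Sum>j\<in>Y. M $ i $ j) > (1 - \<epsilon>) * real (card X))"

definition domestic_matrices :: "real \<Rightarrow> (real ^ 'n ^ 'n) set" where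
  "domestic_matrices \<epsilon> = {M. domestic \<epsilon> M}"

definition topological_semigroup :: "'a topology \<Rightarrow> ('a \<Rightarrow> 'a \<Rightarrow> 'a) \<Rightarrow> bool" where
  "topological_semigroup T f \<longleftrightarrow>
     Hausdorff_space T \<and>
     (\<forall>x\<in>topspace T. \<forall>y\<in>topspace T. f x y \<in> topspace T) \<and>
     (\<forall>x\<in>topspace T. \<forall>y\<in>topspace T. \<forall>z\<in>topspace T. f (f x y) z = f x (f y z)) \<and>
     continuous_map (prod_topology T T) T (\<lambda>(x, y). f x y)"

primrec partial_product :: "('a \<Rightarrow> 'a \<Rightarrow> 'a) \<Rightarrow> (nat \<Rightarrow> 'a) \<Rightarrow> nat \<Rightarrow> 'a" where
  "partial_product f S 0 = S 0"
| "partial_product f S (Suc i) = f (partial_product f S i) (S (Suc i))"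

text \<open>The limit in \<open>limitin\<close> is required to lie in the space itself, so convergence here
  means convergence within the semigroup, not in some ambient space.\<close>

definition convergent_semigroup :: "'a topology \<Rightarrow> ('a \<Rightarrow> 'a \<Rightarrow> 'a) \<Rightarrow> bool" where
  "convergent_semigroup T f \<longleftrightarrow>
     topological_semigroup T f \<and>
     (\<forall>S. (\<forall>i. S i \<in> topspace T) \<longrightarrow>
        (\<exists>L. limitin T (partial_product f S) L sequentially))"

end

theory Submission
  imports Defs
begin

text \<open>
  Closure under products: an entry sum of \<open>M ** N\<close> over \<open>X \<times> Z\<close> is \<open>\<Sum>j. a j * b j\<close>, where \<open>a\<close> and \<open>b\<close>
  have entries in \<open>[0,1]\<close> and total \<open>k = card X\<close>. It is at most the sum of the \<open>k\<close> largest entries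
  of \<open>a\<close>, and likewise for \<open>b\<close>. If it exceeds \<open>(1 - \<epsilon>) * k\<close>, domesticity forces these largest entries
  to sit on \<open>X\<close> and on \<open>Z\<close> respectively, and an exchange argument then bounds the sum by \<open>k - 1/2\<close>.

  Convergence: by compactness some subsequence of the partial products converges. Each row evolves
  by \<open>x \<mapsto> x v* S\<close>, under which every \<open>\<Sum>j. max (x j - c) 0\<close> decreases, hence converges. If \<open>c\<close> is not
  an entry of the limit \<open>z\<close> along the subsequence, then eventually no entry of \<open>x\<close> is near \<open>c\<close> and the
  number of entries above \<open>c\<close> is constant; whenever the set of their positions changes, domesticity
  makes the sum drop by a fixed amount, so the set is eventually constant. Letting \<open>c\<close> vary gives
  convergence to \<open>z\<close>.
\<close>

section \<open>Sums of products and sums over the largest entries\<close>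

lemma ex_top_set:
  fixes a :: "'n::finite \<Rightarrow> real"
  assumes "k \<le> CARD('n)"
  shows "\<exists>T. card T = k \<and> (\<forall>i\<in>T. \<forall>j\<in>-T. a j \<le> a i)"
  using assms
proof (induction k)
  case 0
  then show ?case by (intro exI[of _ "{}"]) auto
next
  case (Suc k)
  then obtain T where T: "card T = k" "\<forall>i\<in>T. \<forall>j\<in>-T. a j \<le> a i" by auto
  have "T \<noteq> UNIV" using T(1) Suc.prems by auto
  then have "-T \<noteq> {}" by blast
  then have "Max (a ` (-T)) \<in> a ` (-T)" by (intro Max_in) auto
  then obtain m where m: "m \<notin> T" "a m = Max (a ` (-T))" by auto
  have "\<forall>j\<in>-T. a j \<le> a m" using m(2) by auto
  then show ?case using T m(1) by (intro exI[of _ "insert m T"]) auto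
qed

text \<open>A threshold \<open>\<tau>\<close> separates the values of \<open>a\<close> on
  \<open>T\<close> from those outside. Passing from the indicator of \<open>T\<close> to
  \<open>b\<close> only moves mass from values at least \<open>\<tau>\<close> to values at most
  \<open>\<tau>\<close>; the multiples of \<open>\<tau>\<close> cancel because both have total
  \<open>card T\<close>.\<close>

lemma sum_mult_le_sum_top_set:
  fixes a b :: "'n::finite \<Rightarrow> real"
  assumes b: "\<And>j. 0 \<le> b j" "\<And>j. b j \<le> 1" "(\<Sum>j\<in>UNIV. b j) = real (card T)"
    and T: "\<forall>i\<in>T. \<forall>j\<in>-T. a j \<le> a i"
  shows "(\<Sum>j\<in>UNIV. a j * b j) \<le> sum a T"
proof -
  obtain \<tau> where \<tau>: "\<forall>i\<in>T. \<tau> \<le> a i" "\<forall>j\<in>-T. a j \<le> \<tau>"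
  proof (cases "T = {}")
    case True
    then show ?thesis using that[of "Max (range a)"] by auto
  next
    case False
    then have "Min (a ` T) \<in> a ` T" by (intro Min_in) auto
    then show ?thesis using that[of "Min (a ` T)"] T by auto
  qed
  have ind: "(\<Sum>j\<in>UNIV. f j * of_bool (j \<in> T)) = sum f T" for f :: "'n \<Rightarrow> real"
    by (simp add: of_bool_def if_distrib sum.If_cases cong: if_cong)
  have "(\<Sum>j\<in>UNIV. (a j - \<tau>) * (b j - of_bool (j \<in> T))) \<le> 0"
  proof (rule sum_nonpos)
    fix j
    show "(a j - \<tau>) * (b j - of_bool (j \<in> T)) \<le> 0"
      using \<tau> b(1,2)[of j] by (cases "j \<in> T") (auto simp: mult_nonneg_nonpos mult_nonpos_nonneg)
  qed
  moreover have "(\<Sum>j\<in>UNIV. (a j - \<tau>) * (b j - of_bool (j \<in> T)))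
     = (\<Sum>j\<in>UNIV. a j * b j) - (\<Sum>j\<in>UNIV. a j * of_bool (j \<in> T))
       - \<tau> * ((\<Sum>j\<in>UNIV. b j) - (\<Sum>j\<in>UNIV. 1 * of_bool (j \<in> T)))"
    by (simp add: sum_subtractf sum_distrib_left algebra_simps sum.distrib)
  ultimately show ?thesis
    unfolding ind using b(3) by simp
qed

text \<open>\<open>T\<close> may be any set. If \<open>j\<close> is in \<open>T\<close>, the other
  entries on \<open>T\<close> are at most 1 each; if not, the mass \<open>a j\<close> is missing
  from the total \<open>card T\<close>.\<close>

lemma top_set_coordinate_bounds:
  fixes a :: "'n::finite \<Rightarrow> real"
  assumes "\<And>j. 0 \<le> a j" "\<And>j. a j \<le> 1" "(\<Sum>j\<in>UNIV. a j) = real (card T)"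
  shows "j \<in> T \<Longrightarrow> sum a T \<le> real (card T) - (1 - a j)"
    and "j \<notin> T \<Longrightarrow> sum a T \<le> real (card T) - a j"
proof -
  assume j: "j \<in> T"
  have "sum a (T - {j}) \<le> real (card (T - {j}))"
    using sum_bounded_above[of "T - {j}" a 1] assms(2) by simp
  moreover have "real (card (T - {j})) = real (card T) - 1"
    using j by (metis card_Suc_Diff1 finite of_nat_Suc add_diff_cancel_left')
  ultimately show "sum a T \<le> real (card T) - (1 - a j)"
    using j by (simp add: sum.remove)
next
  assume j: "j \<notin> T"
  have "a j + sum a T = sum a (insert j T)" using j by simp
  also have "\<dots> \<le> sum a UNIV" by (rule sum_mono2) (use assms in auto)
  finally show "sum a T \<le> real (card T) - a j" using assms(3) by simp
qed

text \<open>Whether or not \<open>j\<close> lies in a top set of \<open>a\<close>, one of the two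
  coordinate bounds applies. An entry equal to 1/2 thus costs 1/2.\<close>

lemma sum_mult_le_of_coordinate:
  fixes a b :: "'n::finite \<Rightarrow> real"
  assumes a: "\<And>j. 0 \<le> a j" "\<And>j. a j \<le> 1" "(\<Sum>j\<in>UNIV. a j) = real k"
    and b: "\<And>j. 0 \<le> b j" "\<And>j. b j \<le> 1" "(\<Sum>j\<in>UNIV. b j) = real k"
  shows "(\<Sum>j\<in>UNIV. a j * b j) \<le> real k - min (a j) (1 - a j)"
proof -
  have "real k \<le> real CARD('n)"
    using sum_bounded_above[of UNIV a 1] a(2,3) by simp
  then obtain T where T: "card T = k" "\<forall>i\<in>T. \<forall>j\<in>-T. a j \<le> a i"
    using ex_top_set[of k a] by auto
  have "(\<Sum>j\<in>UNIV. a j * b j) \<le> sum a T"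
    using sum_mult_le_sum_top_set[of b T a] T b by simp
  then show ?thesis
    using top_set_coordinate_bounds[of a T j] a T(1) by (cases "j \<in> T") auto
qed

text \<open>Moving mass of \<open>b\<close> from \<open>i\<close> to \<open>j\<close> until \<open>b j = 1/2\<close> does not decrease the sum.\<close>

lemma sum_mult_le_of_crossing:
  fixes a b :: "'n::finite \<Rightarrow> real"
  assumes a: "\<And>j. 0 \<le> a j" "\<And>j. a j \<le> 1" "(\<Sum>j\<in>UNIV. a j) = real k"
    and b: "\<And>j. 0 \<le> b j" "\<And>j. b j \<le> 1" "(\<Sum>j\<in>UNIV. b j) = real k"
    and ij: "i \<noteq> j" "1/2 \<le> a j" "b j \<le> 1/2" "a i \<le> 1/2" "1/2 \<le> b i"
  shows "(\<Sum>j\<in>UNIV. a j * b j) \<le> real k - 1/2"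
proof -
  define b' where "b' = b(j := 1/2, i := b i + b j - 1/2)"
  have split: "sum f UNIV = f i + f j + sum f (UNIV - {i,j})" for f :: "'n \<Rightarrow> real"
  proof -
    have "UNIV = insert i (insert j (UNIV - {i,j}))" by auto
    then have "sum f UNIV = sum f (insert i (insert j (UNIV - {i,j})))" by simp
    then show ?thesis using ij(1) by simp
  qed
  have rest: "sum (\<lambda>l. g l (b' l)) (UNIV - {i,j}) = sum (\<lambda>l. g l (b l)) (UNIV - {i,j})"
    for g :: "'n \<Rightarrow> real \<Rightarrow> real"
    by (rule sum.cong) (auto simp: b'_def)
  have b'01: "0 \<le> b' l" "b' l \<le> 1" for l
    using b(1,2)[of l] b(1)[of j] b(2)[of i] ij by (auto simp: b'_def)
  have b'sum: "sum b' UNIV = real k"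
    using b(3) rest[of "\<lambda>l x. x"] ij(1) unfolding split[of b'] split[of b] by (simp add: b'_def)
  \<comment> \<open>The left side is the change of the sum when the amount \<open>1/2 - b j\<close>
    moves from \<open>i\<close> to \<open>j\<close>.\<close>
  have "(a j - a i) * (1/2 - b j) \<ge> 0"
    using ij by (intro mult_nonneg_nonneg) auto
  then have "a j * b j + a i / 2 \<le> a i * b j + a j / 2"
    by (simp add: algebra_simps diff_divide_distrib)
  then have "(\<Sum>l\<in>UNIV. a l * b l) \<le> (\<Sum>l\<in>UNIV. b' l * a l)"
    using rest[of "\<lambda>l x. x * a l"] ij(1)
    unfolding split[of "\<lambda>l. a l * b l"] split[of "\<lambda>l. b' l * a l"]
    by (simp add: b'_def algebra_simps)
  \<comment> \<open>The coordinate bound is applied with \<open>b'\<close> in the role of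
    \<open>a\<close>, at its entry 1/2.\<close>
  also have "\<dots> \<le> real k - min (b' j) (1 - b' j)"
    by (rule sum_mult_le_of_coordinate) (use a b'01 b'sum in auto)
  finally show ?thesis using ij(1) by (simp add: b'_def)
qed

text \<open>A larger sum would leave \<open>X\<close> and \<open>Z\<close> as the only possible top
  sets of \<open>a\<close> and \<open>b\<close>. Since they differ and have equal size, each has an
  element outside the other, and the coordinate bounds at these two elements yield a
  crossing.\<close>

lemma sum_mult_le_of_distinct_top_sets:
  fixes a b :: "'n::finite \<Rightarrow> real"
  assumes a: "\<And>j. 0 \<le> a j" "\<And>j. a j \<le> 1" "(\<Sum>j\<in>UNIV. a j) = real k"
    and b: "\<And>j. 0 \<le> b j" "\<And>j. b j \<le> 1" "(\<Sum>j\<in>UNIV. b j) = real k"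
    and XZ: "card X = k" "card Z = k" "X \<noteq> Z"
    and aX: "\<And>T. card T = k \<Longrightarrow> T \<noteq> X \<Longrightarrow> sum a T \<le> real k - \<delta>"
    and bZ: "\<And>T. card T = k \<Longrightarrow> T \<noteq> Z \<Longrightarrow> sum b T \<le> real k - \<delta>"
    and \<delta>: "\<delta> \<le> 1/2"
  shows "(\<Sum>j\<in>UNIV. a j * b j) \<le> real k - \<delta>"
proof (rule ccontr)
  assume contra: "\<not> ?thesis"
  have kn: "k \<le> CARD('n)" using XZ(1) by (metis card_mono finite subset_UNIV)
  \<comment> \<open>Stated for general \<open>u\<close>, \<open>v\<close> and \<open>W\<close>, to
    serve both for \<open>a\<close> with \<open>X\<close> and for \<open>b\<close> with
    \<open>Z\<close>.\<close>
  have large: "sum u W > real k - \<delta>"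
    if v: "\<And>j. 0 \<le> v j" "\<And>j. v j \<le> 1" "(\<Sum>j\<in>UNIV. v j) = real k"
      and W: "\<And>T. card T = k \<Longrightarrow> T \<noteq> W \<Longrightarrow> sum u T \<le> real k - \<delta>"
      and uv: "(\<Sum>j\<in>UNIV. u j * v j) > real k - \<delta>" for u v :: "'n \<Rightarrow> real" and W
  proof -
    obtain T where T: "card T = k" "\<forall>i\<in>T. \<forall>j\<in>-T. u j \<le> u i"
      using ex_top_set[OF kn] by blast
    have "real k - \<delta> < sum u T"
      using sum_mult_le_sum_top_set[of v T u] v T uv by simp
    then show ?thesis using W[OF T(1)] by fastforce
  qed
  have sa: "sum a X > real k - \<delta>"
    by (rule large[of b]) (use b aX contra in auto)
  have sb: "sum b Z > real k - \<delta>"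
    by (rule large[of a]) (use a bZ contra in \<open>auto simp: mult.commute\<close>)
  obtain j where j: "j \<in> X" "j \<notin> Z" using XZ by (metis card_subset_eq finite subsetI)
  obtain i where i: "i \<in> Z" "i \<notin> X" using XZ by (metis card_subset_eq finite subsetI)
  have "1/2 \<le> a j" "a i \<le> 1/2"
    using top_set_coordinate_bounds[of a X] a XZ(1) i j sa \<delta> by fastforce+
  moreover have "1/2 \<le> b i" "b j \<le> 1/2"
    using top_set_coordinate_bounds[of b Z] b XZ(2) i j sb \<delta> by fastforce+
  ultimately have "(\<Sum>j\<in>UNIV. a j * b j) \<le> real k - 1/2"
    using i j by (intro sum_mult_le_of_crossing[OF a b, of i j]) auto
  then show False using contra \<delta> by simp
qed

section \<open>Doubly stochastic and domestic matrices: products and compactness\<close>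

lemma doubly_stochastic_mult:
  fixes M N :: "real ^ 'n ^ 'n"
  assumes "doubly_stochastic M" "doubly_stochastic N"
  shows "doubly_stochastic (M ** N)"
proof -
  have "(\<Sum>j\<in>UNIV. (M ** N) $ i $ j) = 1" for i
  proof -
    have "(\<Sum>j\<in>UNIV. (M ** N) $ i $ j) = (\<Sum>l\<in>UNIV. \<Sum>j\<in>UNIV. M $ i $ l * N $ l $ j)"
      unfolding matrix_matrix_mult_def by (simp, rule sum.swap)
    also have "\<dots> = 1"
      using assms by (simp add: doubly_stochastic_def flip: sum_distrib_left)
    finally show ?thesis .
  qed
  moreover have "(\<Sum>i\<in>UNIV. (M ** N) $ i $ j) = 1" for j
  proof -
    have "(\<Sum>i\<in>UNIV. (M ** N) $ i $ j) = (\<Sum>l\<in>UNIV. \<Sum>i\<in>UNIV. M $ i $ l * N $ l $ j)"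
      unfolding matrix_matrix_mult_def by (simp, rule sum.swap)
    also have "\<dots> = 1"
      using assms by (simp add: doubly_stochastic_def flip: sum_distrib_right)
    finally show ?thesis .
  qed
  moreover have "0 \<le> (M ** N) $ i $ j" for i j
    using assms unfolding matrix_matrix_mult_def by (simp add: doubly_stochastic_def sum_nonneg)
  ultimately show ?thesis by (simp add: doubly_stochastic_def)
qed

lemma doubly_stochastic_column_sums:
  fixes M :: "real ^ 'n ^ 'n"
  assumes "doubly_stochastic M"
  shows "0 \<le> (\<Sum>i\<in>X. M $ i $ j)" "(\<Sum>i\<in>X. M $ i $ j) \<le> 1"
    "(\<Sum>j\<in>UNIV. \<Sum>i\<in>X. M $ i $ j) = real (card X)"
proof -
  show "0 \<le> (\<Sum>i\<in>X. M $ i $ j)"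
    using assms by (simp add: doubly_stochastic_def sum_nonneg)
  have "(\<Sum>i\<in>X. M $ i $ j) \<le> (\<Sum>i\<in>UNIV. M $ i $ j)"
    by (rule sum_mono2) (use assms in \<open>auto simp: doubly_stochastic_def\<close>)
  then show "(\<Sum>i\<in>X. M $ i $ j) \<le> 1"
    using assms by (simp add: doubly_stochastic_def)
  have "(\<Sum>j\<in>UNIV. \<Sum>i\<in>X. M $ i $ j) = (\<Sum>i\<in>X. \<Sum>j\<in>UNIV. M $ i $ j)"
    by (rule sum.swap)
  then show "(\<Sum>j\<in>UNIV. \<Sum>i\<in>X. M $ i $ j) = real (card X)"
    using assms by (simp add: doubly_stochastic_def)
qed

lemma doubly_stochastic_row_sums:
  fixes M :: "real ^ 'n ^ 'n"
  assumes "doubly_stochastic M"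
  shows "0 \<le> (\<Sum>j\<in>Y. M $ i $ j)" "(\<Sum>j\<in>Y. M $ i $ j) \<le> 1"
    "(\<Sum>i\<in>UNIV. \<Sum>j\<in>Y. M $ i $ j) = real (card Y)"
proof -
  have "doubly_stochastic (transpose M)"
    using assms by (simp add: doubly_stochastic_def transpose_def)
  from doubly_stochastic_column_sums[OF this, where X = Y]
  show "0 \<le> (\<Sum>j\<in>Y. M $ i $ j)" "(\<Sum>j\<in>Y. M $ i $ j) \<le> 1"
    "(\<Sum>i\<in>UNIV. \<Sum>j\<in>Y. M $ i $ j) = real (card Y)"
    by (simp_all add: transpose_def)
qed

text \<open>In this form all conditions are non-strict inequalities or equations, which makes
  closedness immediate.\<close>

lemma domestic_iff:
  "domestic \<epsilon> M \<longleftrightarrow> doubly_stochastic M \<and>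
     (\<forall>X Y. X \<noteq> Y \<longrightarrow> card X = card Y \<longrightarrow>
        (\<Sum>i\<in>X. \<Sum>j\<in>Y. M $ i $ j) \<le> (1 - \<epsilon>) * real (card X))"
  unfolding domestic_def by (auto simp: not_less)

lemma domestic_mult:
  fixes M N :: "real ^ 'n ^ 'n"
  assumes \<epsilon>: "0 < \<epsilon>" "\<epsilon> \<le> 1 / (2 * real CARD('n))"
    and M: "domestic \<epsilon> M" and N: "domestic \<epsilon> N"
  shows "domestic \<epsilon> (M ** N)"
  unfolding domestic_iff
proof (intro conjI allI impI)
  have dM: "doubly_stochastic M" and dN: "doubly_stochastic N"
    using M N by (auto simp: domestic_def)
  then show "doubly_stochastic (M ** N)" by (rule doubly_stochastic_mult)
  fix X Z :: "'n set"
  assume XZ: "X \<noteq> Z" "card X = card Z"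
  define a where "a = (\<lambda>j. \<Sum>i\<in>X. M $ i $ j)"
  define b where "b = (\<lambda>j. \<Sum>l\<in>Z. N $ j $ l)"
  have "(\<Sum>i\<in>X. \<Sum>l\<in>Z. (M ** N) $ i $ l) = (\<Sum>i\<in>X. \<Sum>l\<in>Z. \<Sum>j\<in>UNIV. M $ i $ j * N $ j $ l)"
    by (simp add: matrix_matrix_mult_def)
  also have "\<dots> = (\<Sum>i\<in>X. \<Sum>j\<in>UNIV. \<Sum>l\<in>Z. M $ i $ j * N $ j $ l)"
    by (intro sum.cong refl sum.swap)
  also have "\<dots> = (\<Sum>j\<in>UNIV. \<Sum>i\<in>X. \<Sum>l\<in>Z. M $ i $ j * N $ j $ l)"
    by (rule sum.swap)
  also have "\<dots> = (\<Sum>j\<in>UNIV. a j * b j)"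
    by (simp add: a_def b_def sum_product)
  also have "\<dots> \<le> real (card X) - \<epsilon> * real (card X)"
  proof (rule sum_mult_le_of_distinct_top_sets[where X = X and Z = Z])
    show "sum a T \<le> real (card X) - \<epsilon> * real (card X)" if "card T = card X" "T \<noteq> X" for T
    proof -
      have "sum a T = (\<Sum>i\<in>X. \<Sum>j\<in>T. M $ i $ j)"
        unfolding a_def by (rule sum.swap)
      moreover have "\<dots> \<le> (1 - \<epsilon>) * real (card X)"
        using M that unfolding domestic_iff by metis
      ultimately show ?thesis by (simp add: algebra_simps)
    qed
    show "sum b T \<le> real (card X) - \<epsilon> * real (card X)" if "card T = card X" "T \<noteq> Z" for T
    proof -
      have "sum b T \<le> (1 - \<epsilon>) * real (card T)"
        using N that XZ unfolding domestic_iff b_def by metis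
      then show ?thesis using that by (simp add: algebra_simps)
    qed
    \<comment> \<open>The upper bound on \<open>\<epsilon>\<close> enters here: the loss
      \<open>\<epsilon> * card X\<close> must not exceed the 1/2 guaranteed by a crossing.\<close>
    have "real (card X) \<le> real CARD('n)" by (simp add: card_mono)
    then have "\<epsilon> * real (card X) \<le> 1 / (2 * real CARD('n)) * real CARD('n)"
      using \<epsilon> by (intro mult_mono) auto
    then show "\<epsilon> * real (card X) \<le> 1/2" by simp
  qed (use XZ doubly_stochastic_column_sums[OF dM, where X = X] doubly_stochastic_row_sums[OF dN, where Y = Z]
       in \<open>auto simp: a_def b_def\<close>)
  finally show "(\<Sum>i\<in>X. \<Sum>l\<in>Z. (M ** N) $ i $ l) \<le> (1 - \<epsilon>) * real (card X)"
    by (simp add: algebra_simps)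
qed

lemma compact_domestic_matrices: "compact (domestic_matrices \<epsilon> :: (real ^ 'n ^ 'n) set)"
proof -
  have "closed (domestic_matrices \<epsilon> :: (real ^ 'n ^ 'n) set)"
    unfolding domestic_matrices_def domestic_iff doubly_stochastic_def
    by (intro closed_Collect_conj closed_Collect_all closed_Collect_imp open_Collect_const
        closed_Collect_le closed_Collect_eq continuous_intros)
  moreover have "bounded (domestic_matrices \<epsilon> :: (real ^ 'n ^ 'n) set)"
    unfolding bounded_iff
  proof (intro exI ballI)
    fix M :: "real ^ 'n ^ 'n"
    assume "M \<in> domestic_matrices \<epsilon>"
    then have M: "doubly_stochastic M" by (simp add: domestic_matrices_def domestic_def)
    have "norm M \<le> (\<Sum>i\<in>UNIV. norm (M $ i))"
      by (simp add: norm_vec_def L2_set_le_sum)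
    also have "\<dots> \<le> (\<Sum>i\<in>UNIV. \<Sum>j\<in>UNIV. \<bar>M $ i $ j\<bar>)"
      by (intro sum_mono norm_le_l1_cart)
    also have "\<dots> = real CARD('n)"
      using M by (simp add: doubly_stochastic_def)
    finally show "norm M \<le> real CARD('n)" .
  qed
  ultimately show ?thesis using compact_eq_bounded_closed by blast
qed

section \<open>Hinge sums of a row under a doubly stochastic matrix\<close>

text \<open>For vectors of equal total, majorization is the comparison of these sums for all
  \<open>c\<close>.\<close>

definition hinge_sum :: "real \<Rightarrow> real ^ 'n \<Rightarrow> real" where
  "hinge_sum c x = (\<Sum>j\<in>UNIV. max (x $ j - c) 0)"

lemma continuous_on_hinge_sum [continuous_intros]: "continuous_on A (hinge_sum c)"
  unfolding hinge_sum_def by (intro continuous_intros)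

lemma hinge_sum_eq: "hinge_sum c x = (\<Sum>j | x $ j > c. x $ j - c)"
proof -
  have "hinge_sum c x = (\<Sum>j\<in>UNIV. if x $ j > c then x $ j - c else 0)"
    unfolding hinge_sum_def by (rule sum.cong) (auto simp: max_def)
  then show ?thesis by (simp add: sum.If_cases)
qed

text \<open>Column sums equal to 1 let \<open>c\<close> be subtracted before \<open>S\<close> is
  applied. The inner sums act as weights in [0,1] on the old entries.\<close>

lemma hinge_sum_vector_matrix_mult:
  fixes S :: "real ^ 'n ^ 'n"
  assumes S: "doubly_stochastic S"
  shows "hinge_sum c (x v* S) =
     (\<Sum>i\<in>UNIV. (x $ i - c) * (\<Sum>j | (x v* S) $ j > c. S $ i $ j))"
proof -
  have "(x v* S) $ j - c = (\<Sum>i\<in>UNIV. (x $ i - c) * S $ i $ j)" for j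
  proof -
    have "(\<Sum>i\<in>UNIV. (x $ i - c) * S $ i $ j)
        = (\<Sum>i\<in>UNIV. x $ i * S $ i $ j) - c * (\<Sum>i\<in>UNIV. S $ i $ j)"
      by (simp add: algebra_simps sum_subtractf sum_distrib_left)
    then show ?thesis
      using S by (simp add: vector_matrix_mult_def doubly_stochastic_def mult.commute)
  qed
  then have "hinge_sum c (x v* S) =
      (\<Sum>j | (x v* S) $ j > c. \<Sum>i\<in>UNIV. (x $ i - c) * S $ i $ j)"
    by (simp add: hinge_sum_eq)
  also have "\<dots> = (\<Sum>i\<in>UNIV. \<Sum>j | (x v* S) $ j > c. (x $ i - c) * S $ i $ j)"
    by (rule sum.swap)
  finally show ?thesis by (simp add: sum_distrib_left)
qed

lemma hinge_sum_decreases: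
  fixes S :: "real ^ 'n ^ 'n"
  assumes S: "doubly_stochastic S"
  shows "hinge_sum c (x v* S) \<le> hinge_sum c x"
  unfolding hinge_sum_vector_matrix_mult[OF S] unfolding hinge_sum_def
proof (rule sum_mono)
  fix i
  define w where "w = (\<Sum>j | (x v* S) $ j > c. S $ i $ j)"
  have "0 \<le> w" "w \<le> 1" unfolding w_def by (intro doubly_stochastic_row_sums[OF S])+
  then have "(x $ i - c) * w \<le> max (x $ i - c) 0"
    by (cases "x $ i \<ge> c") (auto simp: max_def mult_left_le mult_nonpos_nonneg)
  then show "(x $ i - c) * (\<Sum>j | (x v* S) $ j > c. S $ i $ j) \<le> max (x $ i - c) 0"
    by (simp add: w_def)
qed

text \<open>Domesticity, applied to the old and new superlevel sets, puts weight at least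
  \<open>\<epsilon>\<close> on old entries not above \<open>c\<close>. By the gap these entries are
  at most \<open>c - \<gamma>\<close>, so this weight costs at least
  \<open>\<gamma> * \<epsilon>\<close>.\<close>

lemma hinge_sum_drop:
  fixes S :: "real ^ 'n ^ 'n"
  assumes \<epsilon>: "0 \<le> \<epsilon>" and S: "domestic \<epsilon> S" and \<gamma>: "0 \<le> \<gamma>"
    and gap: "\<And>i. \<gamma> \<le> \<bar>x $ i - c\<bar>"
    and card: "card {i. x $ i > c} = card {j. (x v* S) $ j > c}"
    and ne: "{i. x $ i > c} \<noteq> {j. (x v* S) $ j > c}"
  shows "hinge_sum c (x v* S) \<le> hinge_sum c x - \<gamma> * \<epsilon>"
proof -
  define T where "T = {i. x $ i > c}"
  define T' where "T' = {j. (x v* S) $ j > c}"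
  define w where "w = (\<lambda>i. \<Sum>j\<in>T'. S $ i $ j)"
  have dS: "doubly_stochastic S" using S by (simp add: domestic_def)
  have w: "0 \<le> w i" "w i \<le> 1" "sum w UNIV = real (card T')" for i
    unfolding w_def by (intro doubly_stochastic_row_sums[OF dS])+
  have "sum w T \<le> (1 - \<epsilon>) * real (card T)"
    using S card ne unfolding domestic_iff w_def T_def T'_def by simp
  moreover have "sum w UNIV = sum w T + sum w (-T)"
    using sum.subset_diff[of T UNIV w] by (simp add: Compl_eq_Diff_UNIV)
  moreover have "card T' = card T" using card by (simp add: T_def T'_def)
  ultimately have "\<epsilon> * real (card T) \<le> sum w (-T)"
    using w(3) by (simp add: algebra_simps)
  \<comment> \<open>If \<open>T\<close> were empty, so would be \<open>T'\<close>, and the two sets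
    would agree.\<close>
  moreover have "card T \<noteq> 0"
    using ne card unfolding T_def T'_def by (metis card_0_eq finite)
  then have "1 \<le> real (card T)" by linarith
  then have "\<epsilon> * 1 \<le> \<epsilon> * real (card T)" using \<epsilon> by (rule mult_left_mono)
  ultimately have \<epsilon>w: "\<epsilon> \<le> sum w (-T)" by simp
  have "hinge_sum c (x v* S) = (\<Sum>i\<in>UNIV. (x $ i - c) * w i)"
    unfolding hinge_sum_vector_matrix_mult[OF dS] w_def T'_def ..
  also have "\<dots> = (\<Sum>i\<in>T. (x $ i - c) * w i) + (\<Sum>i\<in>-T. (x $ i - c) * w i)"
    using sum.subset_diff[of T UNIV "\<lambda>i. (x $ i - c) * w i"] by (simp add: Compl_eq_Diff_UNIV)
  also have "\<dots> \<le> (\<Sum>i\<in>T. x $ i - c) + (\<Sum>i\<in>-T. - \<gamma> * w i)"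
  proof (intro add_mono sum_mono)
    show "(x $ i - c) * w i \<le> x $ i - c" if "i \<in> T" for i
      using that w(2)[of i] by (simp add: T_def mult_left_le)
    show "(x $ i - c) * w i \<le> - \<gamma> * w i" if "i \<in> -T" for i
      using that w(1)[of i] gap[of i] by (intro mult_right_mono) (auto simp: T_def)
  qed
  also have "\<dots> = hinge_sum c x - \<gamma> * sum w (-T)"
    by (simp add: hinge_sum_eq T_def sum_negf flip: sum_distrib_left)
  also have "\<dots> \<le> hinge_sum c x - \<gamma> * \<epsilon>"
    using \<epsilon>w \<gamma> by (simp add: mult_left_mono)
  finally show ?thesis .
qed

text \<open>The tent function of height and half-width \<open>2*\<gamma>\<close> around \<open>c\<close> is a second difference of hinges.\<close>

lemma gap_from_hinge_sums:
  assumes \<gamma>: "0 < \<gamma>"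
    and tent: "hinge_sum (c - 2*\<gamma>) x - 2 * hinge_sum c x + hinge_sum (c + 2*\<gamma>) x < \<gamma>"
  shows "\<gamma> \<le> \<bar>x $ i - c\<bar>"
proof (rule ccontr)
  assume *: "\<not> ?thesis"
  define h where
    "h = (\<lambda>i. max (x $ i - (c - 2*\<gamma>)) 0 - 2 * max (x $ i - c) 0 + max (x $ i - (c + 2*\<gamma>)) 0)"
  \<comment> \<open>Within distance \<open>\<gamma>\<close> of \<open>c\<close> the tent is at least
    \<open>\<gamma>\<close>; being nonnegative everywhere, it cannot be compensated by other
    entries.\<close>
  have "\<gamma> \<le> h i" using * \<gamma> by (auto simp: h_def max_def abs_if split: if_splits)
  also have "\<dots> \<le> sum h UNIV"
    by (rule member_le_sum) (use \<gamma> in \<open>auto simp: h_def max_def\<close>)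
  also have "\<dots> = hinge_sum (c - 2*\<gamma>) x - 2 * hinge_sum c x + hinge_sum (c + 2*\<gamma>) x"
    by (simp add: h_def hinge_sum_def sum.distrib sum_subtractf sum_distrib_left)
  finally show False using tent by simp
qed

text \<open>The difference of the two hinges is a ramp from 0 at \<open>c - \<gamma>\<close> to
  \<open>2 * \<gamma>\<close> at \<open>c + \<gamma>\<close>, and the gap keeps every entry off its
  slope.\<close>

lemma card_from_hinge_sums:
  assumes "0 < \<gamma>" and gap: "\<And>i. \<gamma> \<le> \<bar>x $ i - c\<bar>"
  shows "hinge_sum (c - \<gamma>) x - hinge_sum (c + \<gamma>) x = 2 * \<gamma> * real (card {i. x $ i > c})"
proof -
  have "hinge_sum (c - \<gamma>) x - hinge_sum (c + \<gamma>) x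
      = (\<Sum>i\<in>UNIV. if x $ i > c then 2 * \<gamma> else 0)"
    unfolding hinge_sum_def sum_subtractf[symmetric]
  proof (rule sum.cong)
    fix i
    show "max (x $ i - (c - \<gamma>)) 0 - max (x $ i - (c + \<gamma>)) 0 = (if x $ i > c then 2 * \<gamma> else 0)"
      using gap[of i] \<open>0 < \<gamma>\<close> by (auto simp: max_def abs_if split: if_splits)
  qed simp
  then show ?thesis by (simp add: sum.If_cases)
qed

section \<open>Convergence of orbits and of products\<close>

lemma eventually_superlevel_set_constant:
  fixes x :: "nat \<Rightarrow> real ^ 'n" and S :: "nat \<Rightarrow> real ^ 'n ^ 'n"
  assumes \<epsilon>: "0 < \<epsilon>" and S: "\<And>t. domestic \<epsilon> (S t)" and x: "\<And>t. x (Suc t) = x t v* S t"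
    and r: "strict_mono r" "(x \<circ> r) \<longlonglongrightarrow> z" and c: "\<And>i. z $ i \<noteq> c"
  shows "\<forall>\<^sub>F t in sequentially. {i. x t $ i > c} = {i. z $ i > c}"
proof -
  \<comment> \<open>Half the distance from \<open>c\<close> to the nearest entry of
    \<open>z\<close>: the tent of half-width \<open>2*\<gamma>\<close> then vanishes at every entry
    of \<open>z\<close>.\<close>
  define \<gamma> where "\<gamma> = Min (range (\<lambda>i. \<bar>z $ i - c\<bar>)) / 2"
  have "Min (range (\<lambda>i. \<bar>z $ i - c\<bar>)) \<in> range (\<lambda>i. \<bar>z $ i - c\<bar>)" by (intro Min_in) auto
  then have \<gamma>0: "0 < \<gamma>" using c by (auto simp: \<gamma>_def)
  have \<gamma>z: "2 * \<gamma> \<le> \<bar>z $ i - c\<bar>" for i by (simp add: \<gamma>_def)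
  have \<gamma>z': "\<gamma> \<le> \<bar>z $ i - c\<bar>" for i using \<gamma>z[of i] \<gamma>0 by linarith
  \<comment> \<open>Monotonicity gives a limit along the whole sequence; the subsequence identifies
    it.\<close>
  have lim: "(\<lambda>t. hinge_sum d (x t)) \<longlonglongrightarrow> hinge_sum d z" for d
  proof -
    have "decseq (\<lambda>t. hinge_sum d (x t))"
      using S by (intro decseq_SucI) (auto simp: x domestic_def intro: hinge_sum_decreases)
    moreover have "hinge_sum d (x t) \<ge> 0" for t by (simp add: hinge_sum_def sum_nonneg)
    ultimately obtain L where L: "(\<lambda>t. hinge_sum d (x t)) \<longlonglongrightarrow> L"
      using decseq_convergent by blast
    have "(\<lambda>s. hinge_sum d ((x \<circ> r) s)) \<longlonglongrightarrow> hinge_sum d z"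
      by (rule continuous_on_tendsto_compose[OF continuous_on_hinge_sum[of UNIV] r(2)]) auto
    moreover have "(\<lambda>s. hinge_sum d ((x \<circ> r) s)) \<longlonglongrightarrow> L"
      using LIMSEQ_subseq_LIMSEQ[OF L r(1)] by (simp add: o_def)
    ultimately show ?thesis using L LIMSEQ_unique by blast
  qed
  define T where "T = (\<lambda>t. {i. x t $ i > c})"

  have "hinge_sum (c - 2*\<gamma>) z - 2 * hinge_sum c z + hinge_sum (c + 2*\<gamma>) z = 0"
  proof -
    have "max (z $ i - (c - 2*\<gamma>)) 0 - 2 * max (z $ i - c) 0 + max (z $ i - (c + 2*\<gamma>)) 0 = 0" for i
      using \<gamma>z[of i] \<gamma>0 by (auto simp: max_def abs_if split: if_splits)
    then show ?thesis
      by (simp add: hinge_sum_def sum_distrib_left flip: sum.distrib sum_subtractf)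
  qed
  moreover have "(\<lambda>t. hinge_sum (c - 2*\<gamma>) (x t) - 2 * hinge_sum c (x t) + hinge_sum (c + 2*\<gamma>) (x t))
      \<longlonglongrightarrow> hinge_sum (c - 2*\<gamma>) z - 2 * hinge_sum c z + hinge_sum (c + 2*\<gamma>) z"
    by (intro tendsto_intros lim)
  ultimately have "\<forall>\<^sub>F t in sequentially.
      hinge_sum (c - 2*\<gamma>) (x t) - 2 * hinge_sum c (x t) + hinge_sum (c + 2*\<gamma>) (x t) < \<gamma>"
    using \<gamma>0 by (intro order_tendstoD(2)) auto
  then have gap: "\<forall>\<^sub>F t in sequentially. \<forall>i. \<gamma> \<le> \<bar>x t $ i - c\<bar>"
    by eventually_elim (use gap_from_hinge_sums[OF \<gamma>0] in blast)

  define k where "k = card {i. z $ i > c}"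
  have "(\<lambda>t. hinge_sum (c - \<gamma>) (x t) - hinge_sum (c + \<gamma>) (x t)) \<longlonglongrightarrow> 2 * \<gamma> * real k"
    using tendsto_diff[OF lim lim, of "c - \<gamma>" "c + \<gamma>"] card_from_hinge_sums[OF \<gamma>0 \<gamma>z']
    by (simp add: k_def)
  \<comment> \<open>Different cardinalities give values at least \<open>2 * \<gamma>\<close> apart,
    so this tolerance determines the cardinality.\<close>
  then have "\<forall>\<^sub>F t in sequentially.
      dist (hinge_sum (c - \<gamma>) (x t) - hinge_sum (c + \<gamma>) (x t)) (2 * \<gamma> * real k) < 2 * \<gamma>"
    using \<gamma>0 by (intro tendstoD) auto
  with gap have card: "\<forall>\<^sub>F t in sequentially. card (T t) = k"
  proof eventually_elim
    case (elim t)
    have "\<bar>2 * \<gamma> * real (card (T t)) - 2 * \<gamma> * real k\<bar> < 2 * \<gamma>"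
      using elim card_from_hinge_sums[OF \<gamma>0, of "x t" c] by (simp add: T_def dist_real_def)
    then have "2 * \<gamma> * \<bar>real (card (T t)) - real k\<bar> < 2 * \<gamma> * 1"
      using \<gamma>0 by (simp add: abs_mult flip: right_diff_distrib)
    then have "\<bar>real (card (T t)) - real k\<bar> < 1" using \<gamma>0 by simp
    then show ?case by linarith
  qed

  \<comment> \<open>Successive drops tend to 0, hence eventually stay below the drop
    \<open>\<gamma> * \<epsilon>\<close> that a change of the set would force.\<close>
  have "(\<lambda>t. hinge_sum c (x t) - hinge_sum c (x (Suc t))) \<longlonglongrightarrow> 0"
    using tendsto_diff[OF lim LIMSEQ_Suc[OF lim], of c c] by simp
  then have "\<forall>\<^sub>F t in sequentially. hinge_sum c (x t) - hinge_sum c (x (Suc t)) < \<gamma> * \<epsilon>"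
    using \<gamma>0 \<epsilon> by (intro order_tendstoD(2)) auto
  moreover have "\<forall>\<^sub>F t in sequentially. card (T (Suc t)) = k"
    using card eventually_sequentially_Suc[of "\<lambda>t. card (T t) = k"] by simp
  ultimately have "\<forall>\<^sub>F t in sequentially. T (Suc t) = T t"
    using gap card
  proof eventually_elim
    case (elim t)
    show ?case
    proof (rule ccontr)
      assume "T (Suc t) \<noteq> T t"
      then have "hinge_sum c (x t v* S t) \<le> hinge_sum c (x t) - \<gamma> * \<epsilon>"
        using elim \<gamma>0 \<epsilon> by (intro hinge_sum_drop[OF _ S]) (auto simp: T_def x)
      then show False using elim by (simp add: x)
    qed
  qed
  then obtain t0 where t0: "\<And>t. t \<ge> t0 \<Longrightarrow> T (Suc t) = T t"
    by (auto simp: eventually_sequentially)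
  have const: "T t = T t0" if "t \<ge> t0" for t
    using that by (induction rule: dec_induct) (auto simp: t0)

  \<comment> \<open>The constant set is identified at one late time of the subsequence, where
    \<open>x\<close> is close to \<open>z\<close>.\<close>
  have "\<forall>\<^sub>F s in sequentially. \<forall>i. dist (x (r s) $ i) (z $ i) < \<gamma>"
    using \<gamma>0 r(2) by (intro eventually_all_finite tendstoD tendsto_vec_nth) (auto simp: o_def)
  then have "\<forall>\<^sub>F s in sequentially. T (r s) = {i. z $ i > c}"
  proof eventually_elim
    case (elim s)
    have "x (r s) $ i > c \<longleftrightarrow> z $ i > c" for i
      using elim[rule_format, of i] \<gamma>z[of i] \<gamma>0 by (auto simp: dist_real_def abs_if split: if_splits)
    then show ?case by (simp add: T_def)
  qed
  then have "\<forall>\<^sub>F s in sequentially. s \<ge> t0 \<and> T (r s) = {i. z $ i > c}"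
    by (intro eventually_conj eventually_ge_at_top)
  then obtain s where s: "s \<ge> t0" "T (r s) = {i. z $ i > c}"
    using eventually_happens'[OF sequentially_bot] by blast
  have "r s \<ge> t0" using s(1) seq_suble[OF r(1), of s] by simp
  then have "T t = {i. z $ i > c}" if "t \<ge> t0" for t
    using const s(2) that by metis
  then show ?thesis unfolding T_def eventually_sequentially by blast
qed

text \<open>Each coordinate is squeezed between thresholds that are not entries of \<open>z\<close>;
  since \<open>z\<close> has finitely many entries, such thresholds exist in every open
  interval.\<close>

lemma domestic_orbit_converges:
  fixes x :: "nat \<Rightarrow> real ^ 'n" and S :: "nat \<Rightarrow> real ^ 'n ^ 'n"
  assumes \<epsilon>: "0 < \<epsilon>" and S: "\<And>t. domestic \<epsilon> (S t)" and x: "\<And>t. x (Suc t) = x t v* S t"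
    and r: "strict_mono r" "(x \<circ> r) \<longlonglongrightarrow> z"
  shows "x \<longlonglongrightarrow> z"
proof (rule vec_tendstoI, rule order_tendstoI)
  have pick: "\<exists>c. a < c \<and> c < b \<and> (\<forall>i. z $ i \<noteq> c)" if "a < b" for a b
  proof -
    have "infinite ({a<..<b} - range (\<lambda>i. z $ i))"
      using that by (intro Diff_infinite_finite) auto
    then obtain c where "c \<in> {a<..<b} - range (\<lambda>i. z $ i)" 
      using infinite_imp_nonempty by blast
    then show ?thesis by auto
  qed
  fix j a
  show "\<forall>\<^sub>F t in sequentially. a < x t $ j" if a: "a < z $ j"
  proof -
    obtain c where c: "a < c" "c < z $ j" "\<forall>i. z $ i \<noteq> c" using pick[OF a] by auto
    have "\<forall>\<^sub>F t in sequentially. {i. x t $ i > c} = {i. z $ i > c}"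
      by (rule eventually_superlevel_set_constant[OF \<epsilon> S x r]) (use c in auto)
    then show ?thesis
    proof eventually_elim
      case (elim t)
      then have "x t $ j > c \<longleftrightarrow> z $ j > c" by blast
      then have "x t $ j > c" using c(2) by simp
      then show ?case using c(1) by simp
    qed
  qed
  show "\<forall>\<^sub>F t in sequentially. x t $ j < a" if a: "z $ j < a"
  proof -
    obtain c where c: "z $ j < c" "c < a" "\<forall>i. z $ i \<noteq> c" using pick[OF a] by auto
    have "\<forall>\<^sub>F t in sequentially. {i. x t $ i > c} = {i. z $ i > c}"
      by (rule eventually_superlevel_set_constant[OF \<epsilon> S x r]) (use c in auto)
    then show ?thesis
    proof eventually_elim
      case (elim t)
      then have "x t $ j > c \<longleftrightarrow> z $ j > c" by blast
      then have "x t $ j \<le> c" using c(1) by simp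
      then show ?case using c(2) by simp
    qed
  qed
qed

lemma domestic_products_converge:
  fixes S :: "nat \<Rightarrow> real ^ 'n ^ 'n"
  assumes \<epsilon>: "0 < \<epsilon>" "\<epsilon> \<le> 1 / (2 * real CARD('n))" and S: "\<And>t. domestic \<epsilon> (S t)"
  shows "\<exists>L\<in>domestic_matrices \<epsilon>. partial_product (**) S \<longlonglongrightarrow> L"
proof -
  define P where "P = partial_product (**) S"
  have P: "P t \<in> domestic_matrices \<epsilon>" for t
    by (induction t) (simp_all add: P_def domestic_matrices_def S domestic_mult[OF \<epsilon>])
  obtain L r where L: "L \<in> domestic_matrices \<epsilon>" "strict_mono r" "(P \<circ> r) \<longlonglongrightarrow> L"
    using compact_domestic_matrices P unfolding compact_def by metis
  have "P \<longlonglongrightarrow> L"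
  proof (rule vec_tendstoI)
    fix i
    \<comment> \<open>The product starts with \<open>S 0\<close>, so row \<open>i\<close> is an
      orbit under the shifted sequence \<open>S (Suc t)\<close>.\<close>
    have step: "P (Suc t) $ i = (P t $ i) v* S (Suc t)" for t
      by (simp add: P_def vec_eq_iff matrix_matrix_mult_def vector_matrix_mult_def mult.commute)
    have sub: "((\<lambda>t. P t $ i) \<circ> r) \<longlonglongrightarrow> L $ i"
      using tendsto_vec_nth[OF L(3), of i] by (simp add: o_def)
    show "(\<lambda>t. P t $ i) \<longlonglongrightarrow> L $ i"
      by (rule domestic_orbit_converges[OF \<epsilon>(1) S step L(2) sub])
  qed
  then show ?thesis using L(1) by (auto simp: P_def)
qed

theorem theorem5p5:
  fixes \<epsilon> :: real
  assumes "0 < \<epsilon>" and "\<epsilon> \<le> 1 / (2 * real CARD('n::finite))"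
  shows "compact_space (top_of_set (domestic_matrices \<epsilon> :: (real ^ 'n ^ 'n) set)) \<and>
         convergent_semigroup (top_of_set (domestic_matrices \<epsilon> :: (real ^ 'n ^ 'n) set)) (**)"
proof
  let ?D = "domestic_matrices \<epsilon> :: (real ^ 'n ^ 'n) set"
  show "compact_space (top_of_set ?D)"
    using compact_domestic_matrices[of \<epsilon>, where 'n = 'n] by (simp add: compact_space_subtopology compactin_euclidean_iff)
  have mult: "M ** N \<in> ?D" if "M \<in> ?D" "N \<in> ?D" for M N
    using that domestic_mult[OF assms] by (simp add: domestic_matrices_def)
  have "continuous_on (?D \<times> ?D) (\<lambda>(M, N). M ** N)"
    unfolding matrix_matrix_mult_def case_prod_beta by (intro continuous_intros)
  then have "continuous_map (prod_topology (top_of_set ?D) (top_of_set ?D)) (top_of_set ?D)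
      (\<lambda>(M, N). M ** N)"
    using mult by (auto simp: continuous_map_in_subtopology simp flip: subtopology_Times)
  then have "topological_semigroup (top_of_set ?D) (**)"
    using mult by (auto simp: topological_semigroup_def matrix_mul_assoc Hausdorff_space_subtopology)
  moreover have "\<exists>L. limitin (top_of_set ?D) (partial_product (**) S) L sequentially"
    if "\<forall>t. S t \<in> ?D" for S
  proof -
    have S: "domestic \<epsilon> (S t)" for t using that by (simp add: domestic_matrices_def)
    then obtain L where L: "L \<in> ?D" "partial_product (**) S \<longlonglongrightarrow> L"
      using domestic_products_converge[OF assms] by blast
    \<comment> \<open>Convergence in the subspace topology also requires the partial products to lie
      eventually in \<open>?D\<close>.\<close>
    have "partial_product (**) S t \<in> ?D" for t
      using that mult by (induction t) auto
    then show ?thesis using L by (auto simp: limitin_subtopology)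
  qed
  ultimately show "convergent_semigroup (top_of_set ?D) (**)"
    by (simp add: convergent_semigroup_def)
qed

end
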